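(* Consider the following optimization problem over real variables $c_1^o,\dots,c_F^o$: $$\min_{\{c_i^o\}}\ \sum_{i=1}^F f_i\left(L-c_i^o-\frac{L}{\mu}\log(1+\tau)\sum_{n=0}^\infty p_n\sum_{\{d_i^1,\dots,d_i^n\}\in\mathcal E}p_{\{d_i^1,\dots,d_i^n\}}\,u\,\mathbb P[\rho>\tau\mid u]\right)^+$$ $$\text{subject to}\quad 0\le c_i^o\le L\ \ \text{for all } i\in\{1,\dots,F\},\qquad \sum_{i=1}^F c_i^o\le M.$$ Define $$\zeta=\frac{L}{\mu}\log(1+\tau)\sum_{n=0}^\infty p_n\sum_{\{d_i^1,\dots,d_i^n\}\in\mathcal E}p_{\{d_i^1,\dots,d_i^n\}}\,u\,\mathbb P[\rho>\tau\mid u].$$ The optimal solution $\{c_{i,\mathrm{NOM}}^o\}$ of this problem is $$c_{i,\mathrm{NOM}}^o=\begin{cases}L-\zeta & \text{for } i<k,\\ M-(k-1)(L-\zeta) & \text{for } i=k,\\ 0&\text{for } i>k,\end{cases}$$ where $k=\left\lceil \frac{M}{L-\zeta}\right\rceil$.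
   Context: A typical user can cache up to $M$ packets from a library of $F$ contents, each consisting of $L$ packets; $c_i^o$ is the number of packets of content $i$ cached by the typical user, relaxed to a continuous variable. $(x)^+=\max\{0,x\}$. Content $i$ is requested with probability $f_i=i^{-\gamma}/\sum_{j=1}^F j^{-\gamma}$ (Zipf distribution with exponent $\gamma$). $p_n=\left(\frac{\eta\lambda}{\mu}\right)^n\frac{e^{-\eta\lambda/\mu}}{n!}$ is the probability that $n$ neighboring users capable of transmitting are in the device-to-device communication area (a disc of radius $R$ around the typical user), where $\lambda$ and $\mu$ are the mean rates of the Poisson arrival and departure processes of users and $\eta$ is the probability that a user has enough energy to transmit; $T=1/\mu$ is the expected time of stay. $d_i^\ell$ is the number of packets of content $i$ cached by neighboring user $\ell$; it takes its value with probability $p_{d_i^\ell}$, these distributions being generic but independent and identical among neighboring users, so $p_{\{d_i^1,\dots,d_i^n\}}=\prod_{\ell=1}^n p_{d_i^\ell}$. $\mathcal E$ is the set of all feasible content placements of the $n$ neighboring users, and $u$ is the number of non-zero elements of $(d_i^1,\dots,d_i^n)$, i.e. the number of transmitting users; the terms with $u=0$ are $0$. $\zeta$ is written without an index $i$. For $u$ transmitting users, $\mathbb P[\rho>\tau\mid u]=\int_0^R \exp\left(-r^\alpha\left(\frac{P_t}{\sigma^2}\right)^{-1}\tau\right)\left(\int_0^R\frac{x^\alpha}{x^\alpha+\tau r^\alpha}\frac{2x}{R^2}\,dx\right)^{u-1}\frac{2r}{R^2}\,dr$ is the successful transmission probability of a packet, where $\rho$ is the signal-to-interference-plus-noise ratio,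 $\tau$ its threshold, $\alpha$ the path-loss exponent, $P_t$ the transmit power and $\sigma^2$ the noise power. The problem is the relaxed minimization, in the high mobility regime $T\ll1$ and with non-orthogonal multiple access, of an approximation of the average data load of a base station. *)

theory Defs
  imports "HOL-Probability.Probability"
begin

text \<open>Contents are indexed by \<open>{1..F}\<close>. The constraints are polymorphic so that the same
  predicate covers packet counts (\<open>nat\<close>) and their relaxation to \<open>real\<close>.\<close>

definition feasible_cache :: "nat \<Rightarrow> nat \<Rightarrow> nat \<Rightarrow> (nat \<Rightarrow> 'a::linordered_semidom) \<Rightarrow> bool" where
  "feasible_cache F L M c \<longleftrightarrow>
     (\<forall>i\<in>{1..F}. 0 \<le> c i \<and> c i \<le> of_nat L) \<and> (\<Sum>i=1..F. c i) \<le> of_nat M"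

definition zipf :: "nat \<Rightarrow> real \<Rightarrow> nat \<Rightarrow> real" where
  "zipf F \<gamma> i = real i powr (- \<gamma>) / (\<Sum>j=1..F. real j powr (- \<gamma>))"

definition neighbour_prob :: "real \<Rightarrow> real \<Rightarrow> real \<Rightarrow> nat \<Rightarrow> real" where
  "neighbour_prob \<eta> lam \<mu> n = (\<eta> * lam / \<mu>) ^ n * exp (- (\<eta> * lam / \<mu>)) / fact n"

text \<open>The probability that the SINR exceeds the threshold \<open>\<tau>\<close> given \<open>u\<close> transmitters.
  It is meant for \<open>u \<ge> 1\<close>; below it is always multiplied by \<open>u\<close>, so the truncated exponent
  \<open>u - 1\<close> at \<open>u = 0\<close> is immaterial.\<close>

definition success_prob :: "real \<Rightarrow> real \<Rightarrow> real \<Rightarrow> real \<Rightarrow> real \<Rightarrow> nat \<Rightarrow> real" where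
  "success_prob R \<alpha> Pt \<sigma> \<tau> u =
     integral {0..R} (\<lambda>r.
       exp (- (r powr \<alpha>) * inverse (Pt / \<sigma>\<^sup>2) * \<tau>)
       * (integral {0..R} (\<lambda>x. x powr \<alpha> / (x powr \<alpha> + \<tau> * r powr \<alpha>) * (2 * x / R\<^sup>2))) ^ (u - 1)
       * (2 * r / R\<^sup>2))"

text \<open>The numbers of packets of content \<open>i\<close> occurring in a feasible cache of one user.\<close>

definition feasible_counts :: "nat \<Rightarrow> nat \<Rightarrow> nat \<Rightarrow> nat \<Rightarrow> nat set" where
  "feasible_counts F L M i = {c i | c :: nat \<Rightarrow> nat. feasible_cache F L M c}"

definition placements :: "nat \<Rightarrow> nat \<Rightarrow> nat \<Rightarrow> nat \<Rightarrow> nat \<Rightarrow> (nat \<Rightarrow> nat) set" where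
  "placements F L M i n = {1..n} \<rightarrow>\<^sub>E feasible_counts F L M i"

definition transmitters :: "nat \<Rightarrow> (nat \<Rightarrow> nat) \<Rightarrow> nat" where
  "transmitters n d = card {l \<in> {1..n}. d l \<noteq> 0}"

text \<open>The amount of content \<open>i\<close> delivered by neighbours. Here \<open>b\<close> is the base of the logarithm in
  the rate \<open>log (1 + \<tau>)\<close>, and \<open>q\<close> is the common distribution of the number of packets of content
  \<open>i\<close> cached by one neighbour; independence among neighbours gives the product.\<close>

definition d2d_delivery ::
  "nat \<Rightarrow> nat \<Rightarrow> nat \<Rightarrow> real \<Rightarrow> real \<Rightarrow> real \<Rightarrow> real \<Rightarrow> real \<Rightarrow> real \<Rightarrow> real \<Rightarrow> real \<Rightarrow> real
   \<Rightarrow> nat pmf \<Rightarrow> nat \<Rightarrow> real" where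
  "d2d_delivery F L M b \<eta> lam \<mu> R \<alpha> Pt \<sigma> \<tau> q i =
     real L / \<mu> * log b (1 + \<tau>) *
       (\<Sum>n. neighbour_prob \<eta> lam \<mu> n *
         (\<Sum>d\<in>placements F L M i n.
            (\<Prod>l=1..n. pmf q (d l)) * real (transmitters n d)
            * success_prob R \<alpha> Pt \<sigma> \<tau> (transmitters n d)))"

text \<open>Here \<open>z i\<close> is the amount of content \<open>i\<close> delivered by neighbours.\<close>

definition bs_load :: "nat \<Rightarrow> nat \<Rightarrow> real \<Rightarrow> (nat \<Rightarrow> real) \<Rightarrow> (nat \<Rightarrow> real) \<Rightarrow> real" where
  "bs_load F L \<gamma> z c = (\<Sum>i=1..F. zipf F \<gamma> i * max 0 (real L - c i - z i))"

definition c_NOM :: "nat \<Rightarrow> nat \<Rightarrow> real \<Rightarrow> nat \<Rightarrow> real" where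
  "c_NOM L M \<zeta> i =
     (let k = \<lceil>real M / (real L - \<zeta>)\<rceil> in
      if int i < k then real L - \<zeta>
      else if int i = k then real M - (of_int k - 1) * (real L - \<zeta>)
      else 0)"

end

theory Submission
  imports Defs
begin

text \<open>With \<open>A = L - \<zeta>\<close> the load is \<open>\<Sum>i. f i * max 0 (A - c i)\<close> with nonincreasing weights \<open>f\<close>, so
  filling the contents greedily up to \<open>A\<close> is optimal by Lagrangian duality: with the multiplier
  \<open>v = f k\<close> of the capacity constraint, each summand is bounded below by its value at the greedy
  point minus \<open>v\<close> times the change in \<open>c i\<close>. If \<open>\<gamma> > 0\<close> the weights decrease strictly, and equality in
  these bounds forces the greedy point. The greedy point is feasible only if \<open>\<zeta> \<ge> 0\<close>, which requires
  convergence of the series defining \<open>\<zeta>\<close>; it is dominated by \<open>n * p\<^sub>n\<close>. If \<open>A \<le> 0\<close> the load of the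
  empty cache is zero.\<close>

section \<open>Bounds on the success probability\<close>

text \<open>If \<open>g\<close> is not integrable, its \<open>integral\<close> is 0 by convention,
  so the bounds still hold. This spares integrability proofs for the nested integrals.\<close>

lemma integral_dominated_bounds:
  fixes g h :: "real \<Rightarrow> real"
  assumes "(h has_integral I) S" "\<And>x. x \<in> S \<Longrightarrow> 0 \<le> g x" "\<And>x. x \<in> S \<Longrightarrow> g x \<le> h x"
  shows "0 \<le> integral S g \<and> integral S g \<le> I"
proof (cases "g integrable_on S")
  case True
  then show ?thesis
    using assms by (auto intro!: integral_nonneg intro: has_integral_le)
next
  case False
  have "0 \<le> I"
    using has_integral_nonneg[OF assms(1)] assms(2,3) by (meson order_trans)
  with False show ?thesis
    by (simp add: not_integrable_integral)
qed

text \<open>The integrand is the density of the distance from the centre to a uniform point of a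
  disc of radius \<open>R\<close>. It dominates both integrands in
  \<open>success_prob\<close>.\<close>

lemma has_integral_disc_radius:
  fixes R :: real
  assumes "R > 0"
  shows "((\<lambda>x. 2 * x / R\<^sup>2) has_integral 1) {0..R}"
proof -
  have "((\<lambda>x. 2 * x / R\<^sup>2) has_integral (R\<^sup>2 / R\<^sup>2 - 0\<^sup>2 / R\<^sup>2)) {0..R}"
    using assms
    by (intro fundamental_theorem_of_calculus)
      (auto intro!: derivative_eq_intros simp: field_simps power2_eq_square power4_eq_xxxx
        simp flip: has_real_derivative_iff_has_vector_derivative)
  with assms show ?thesis
    by simp
qed

lemma success_prob_bounds:
  assumes "R > 0" "Pt > 0" "\<tau> > 0"
  shows "0 \<le> success_prob R \<alpha> Pt \<sigma> \<tau> u \<and> success_prob R \<alpha> Pt \<sigma> \<tau> u \<le> 1"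
proof -
  define J where "J r = integral {0..R}
    (\<lambda>x. x powr \<alpha> / (x powr \<alpha> + \<tau> * r powr \<alpha>) * (2 * x / R\<^sup>2))" for r
  \<comment> \<open>Where the denominator vanishes, the quotient is 0 by convention.\<close>
  have frac: "0 \<le> x powr \<alpha> / (x powr \<alpha> + \<tau> * r powr \<alpha>)"
    "x powr \<alpha> / (x powr \<alpha> + \<tau> * r powr \<alpha>) \<le> 1" for x r :: real
    using assms by (auto intro!: divide_nonneg_nonneg add_nonneg_nonneg simp: divide_le_eq_1)
       (smt (verit) mult_nonneg_nonneg powr_ge_zero)+
  have J: "0 \<le> J r \<and> J r \<le> 1" for r
    unfolding J_def
    by (rule integral_dominated_bounds[OF has_integral_disc_radius[OF assms(1)]])
      (rule mult_nonneg_nonneg[OF frac(1)] mult_left_le_one_le[OF _ frac], use assms in simp)+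
  have E: "0 \<le> exp (- (r powr \<alpha>) * inverse (Pt / \<sigma>\<^sup>2) * \<tau>) * J r ^ (u - 1)"
    "exp (- (r powr \<alpha>) * inverse (Pt / \<sigma>\<^sup>2) * \<tau>) * J r ^ (u - 1) \<le> 1" for r
    using assms J[of r] by (auto intro!: mult_le_one power_le_one)
  show ?thesis
    unfolding success_prob_def J_def[symmetric]
    by (rule integral_dominated_bounds[OF has_integral_disc_radius[OF assms(1)]])
      (rule mult_nonneg_nonneg[OF E(1)] mult_left_le_one_le[OF _ E], use assms in simp)+
qed

section \<open>Convergence and sign of the delivery series\<close>

lemma finite_feasible_counts:
  assumes "i \<in> {1..F}"
  shows "finite (feasible_counts F L M i)"
proof (rule finite_subset)
  show "feasible_counts F L M i \<subseteq> {..L}"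
    using assms by (auto simp: feasible_counts_def feasible_cache_def)
qed simp

text \<open>By independence the sum over the product set factorises into the \<open>n\<close>-th
  power of a probability.\<close>

lemma sum_placements_prob_le_1:
  assumes "i \<in> {1..F}"
  shows "(\<Sum>d\<in>placements F L M i n. \<Prod>l=1..n. pmf q (d l)) \<le> 1"
proof -
  have fin: "finite (feasible_counts F L M i)"
    by (rule finite_feasible_counts[OF assms])
  have "(\<Sum>d\<in>placements F L M i n. \<Prod>l=1..n. pmf q (d l))
    = (\<Prod>l=1..n. \<Sum>x\<in>feasible_counts F L M i. pmf q x)"
    unfolding placements_def using fin by (subst prod_sum_PiE) auto
  also have "\<dots> = measure q (feasible_counts F L M i) ^ n"
    using fin by (simp add: measure_measure_pmf_finite)
  also have "\<dots> \<le> 1"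
    by (intro power_le_one) auto
  finally show ?thesis .
qed

lemma transmitters_le: "transmitters n d \<le> n"
proof -
  have "card {l \<in> {1..n}. d l \<noteq> 0} \<le> card {1..n}"
    by (intro card_mono) auto
  then show ?thesis
    by (simp add: transmitters_def)
qed

lemma neighbour_prob_nonneg:
  assumes "0 \<le> \<eta> * lam / \<mu>"
  shows "0 \<le> neighbour_prob \<eta> lam \<mu> n"
  unfolding neighbour_prob_def using assms by (intro divide_nonneg_nonneg mult_nonneg_nonneg) auto

text \<open>This is the series for the mean of a Poisson variable: after an index shift the factor
  \<open>n\<close> cancels against the factorial and leaves an exponential series.\<close>

lemma summable_neighbour_prob_mult: "summable (\<lambda>n. neighbour_prob \<eta> lam \<mu> n * real n)"
proof -
  define x where "x = \<eta> * lam / \<mu>"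
  have "summable (\<lambda>n. x * exp (- x) * (inverse (fact n) * x ^ n))"
    by (intro summable_mult summable_exp)
  also have "(\<lambda>n. x * exp (- x) * (inverse (fact n) * x ^ n))
    = (\<lambda>n. neighbour_prob \<eta> lam \<mu> (Suc n) * real (Suc n))"
    unfolding neighbour_prob_def x_def[symmetric]
    by (simp add: fun_eq_iff field_simps del: of_nat_Suc)
  finally show ?thesis
    by (rule iffD1[OF summable_Suc_iff[where f = "\<lambda>n. neighbour_prob \<eta> lam \<mu> n * real n"]])
qed

text \<open>The value of \<open>suminf\<close> is unspecified for a divergent series, so summability
  has to precede the sign. The inner sum is at most \<open>n\<close>, because at most
  \<open>n\<close> users transmit.\<close>

lemma d2d_delivery_nonneg:
  assumes "i \<in> {1..F}" "b > 1" "0 \<le> \<eta>" "lam > 0" "\<mu> > 0" "R > 0" "Pt > 0" "\<tau> > 0"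
  shows "0 \<le> d2d_delivery F L M b \<eta> lam \<mu> R \<alpha> Pt \<sigma> \<tau> q i"
proof -
  define S where "S n = (\<Sum>d\<in>placements F L M i n.
    (\<Prod>l=1..n. pmf q (d l)) * real (transmitters n d)
      * success_prob R \<alpha> Pt \<sigma> \<tau> (transmitters n d))" for n
  note sp = success_prob_bounds[OF assms(6-8), of \<alpha> \<sigma>]
  have p: "0 \<le> neighbour_prob \<eta> lam \<mu> n" for n
    using assms by (intro neighbour_prob_nonneg) auto
  have S0: "0 \<le> S n" for n
    unfolding S_def using sp by (intro sum_nonneg mult_nonneg_nonneg prod_nonneg) auto
  have Sn: "S n \<le> real n" for n
  proof -
    have "S n \<le> (\<Sum>d\<in>placements F L M i n. (\<Prod>l=1..n. pmf q (d l)) * real n * 1)"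
      unfolding S_def using sp transmitters_le
      by (intro sum_mono mult_mono mult_nonneg_nonneg prod_nonneg) auto
    also have "\<dots> = (\<Sum>d\<in>placements F L M i n. \<Prod>l=1..n. pmf q (d l)) * real n"
      by (simp add: sum_distrib_right)
    also have "\<dots> \<le> 1 * real n"
      by (intro mult_right_mono sum_placements_prob_le_1 assms(1)) simp
    finally show ?thesis by simp
  qed
  have "summable (\<lambda>n. neighbour_prob \<eta> lam \<mu> n * S n)"
    using p S0 Sn
    by (intro summable_comparison_test'[OF summable_neighbour_prob_mult[of \<eta> lam \<mu>], of 0])
      (auto simp: abs_mult intro!: mult_left_mono)
  then have "0 \<le> (\<Sum>n. neighbour_prob \<eta> lam \<mu> n * S n)"
    using p S0 by (intro suminf_nonneg) auto
  with assms show ?thesis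
    unfolding d2d_delivery_def S_def[symmetric] by (intro mult_nonneg_nonneg) auto
qed

section \<open>Monotonicity of the Zipf weights\<close>

lemma zipf_pos:
  assumes "i \<in> {1..F}"
  shows "0 < zipf F \<gamma> i"
proof -
  have "0 < (\<Sum>j=1..F. real j powr (- \<gamma>))"
    using assms by (intro sum_pos) auto
  with assms show ?thesis
    by (simp add: zipf_def)
qed

lemma zipf_antimono:
  assumes "\<gamma> \<ge> 0" "i \<ge> 1" "i \<le> j"
  shows "zipf F \<gamma> j \<le> zipf F \<gamma> i"
  unfolding zipf_def using assms
  by (intro divide_right_mono powr_mono2' sum_nonneg) auto

lemma zipf_strict_antimono:
  assumes "\<gamma> > 0" "i \<ge> 1" "i < j" "j \<le> F"
  shows "zipf F \<gamma> j < zipf F \<gamma> i"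
proof -
  have "0 < (\<Sum>j=1..F. real j powr (- \<gamma>))"
    using assms by (intro sum_pos) auto
  with assms show ?thesis
    unfolding zipf_def by (intro divide_strict_right_mono powr_less_mono2_neg) auto
qed

section \<open>Greedy filling\<close>

text \<open>This is \<open>c_NOM\<close> with a free natural index \<open>k\<close>, so that the
  ceiling enters later arguments only through inequalities on \<open>k\<close>.\<close>

definition greedy_fill :: "real \<Rightarrow> real \<Rightarrow> nat \<Rightarrow> nat \<Rightarrow> real" where
  "greedy_fill A m k i = (if i < k then A else if i = k then m - (real k - 1) * A else 0)"

lemma c_NOM_eq_greedy_fill:
  assumes "real L - \<zeta> > 0"
  shows "c_NOM L M \<zeta>
    = greedy_fill (real L - \<zeta>) (real M) (nat \<lceil>real M / (real L - \<zeta>)\<rceil>)"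
proof -
  have "0 \<le> real M / (real L - \<zeta>)"
    using assms by simp
  then have "\<lceil>real M / (real L - \<zeta>)\<rceil> = int (nat \<lceil>real M / (real L - \<zeta>)\<rceil>)"
    by linarith
  then show ?thesis
    unfolding fun_eq_iff c_NOM_def greedy_fill_def Let_def
    by (smt (verit) of_int_of_nat_eq of_nat_eq_iff of_nat_less_iff)
qed

lemma sum_greedy_fill:
  fixes m :: real
  assumes "1 \<le> k" "k \<le> F"
  shows "(\<Sum>i=1..F. greedy_fill A m k i) = m"
proof -
  have "{1..F} = {1..<k} \<union> {k} \<union> {k<..F}"
    using assms by auto
  then have "(\<Sum>i=1..F. greedy_fill A m k i) = (\<Sum>i\<in>{1..<k}. greedy_fill A m k i)
    + greedy_fill A m k k + (\<Sum>i\<in>{k<..F}. greedy_fill A m k i)"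
    by (simp only:) (subst sum.union_disjoint; auto simp: sum.union_disjoint)
  also have "\<dots> = real (k - 1) * A + (m - (real k - 1) * A)"
    by (simp add: greedy_fill_def)
  finally show ?thesis
    using assms by (simp add: of_nat_diff)
qed

lemma greedy_fill_bounds:
  assumes "A \<ge> 0" "(real k - 1) * A \<le> m" "m \<le> real k * A"
  shows "0 \<le> greedy_fill A m k i \<and> greedy_fill A m k i \<le> A"
  using assms by (auto simp: greedy_fill_def algebra_simps)

section \<open>Lagrangian duality for the greedy point\<close>

text \<open>As a function of \<open>c i\<close>, the term
  \<open>f i * max 0 (A - c i) + v * c i\<close> has slope \<open>v - f i\<close> below
  \<open>A\<close> and \<open>v\<close> above. It is thus least at \<open>A\<close> if
  \<open>v \<le> f i\<close> and at 0 if \<open>f i \<le> v\<close>; for \<open>v = f i\<close> it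
  is constant up to \<open>A\<close>.\<close>

lemma lagrangian_bound:
  fixes f c :: "nat \<Rightarrow> real"
  assumes "0 \<le> c i" "0 \<le> v" "0 \<le> f i"
    and "i < k \<Longrightarrow> v \<le> f i" "i = k \<Longrightarrow> v = f i" "k < i \<Longrightarrow> f i \<le> v"
  shows "f i * (A - greedy_fill A m k i) - v * (c i - greedy_fill A m k i)
    \<le> f i * max 0 (A - c i)"
proof -
  have max: "f i * (A - c i) \<le> f i * max 0 (A - c i)"
    using assms by (intro mult_left_mono) auto
  consider "i < k" | "i = k" | "k < i" by linarith
  then show ?thesis
  proof cases
    case 1
    have "v * (A - c i) \<le> v * max 0 (A - c i)"
      using assms by (intro mult_left_mono) auto
    also have "\<dots> \<le> f i * max 0 (A - c i)"
      using assms 1 by (intro mult_right_mono) auto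
    finally show ?thesis
      using 1 by (simp add: greedy_fill_def algebra_simps)
  next
    case 2
    then show ?thesis
      using max assms(5) by (simp add: algebra_simps)
  next
    case 3
    then have "f i * c i \<le> v * c i"
      using assms by (intro mult_right_mono) auto
    then show ?thesis
      using 3 max by (simp add: greedy_fill_def algebra_simps)
  qed
qed

text \<open>Away from \<open>k\<close> the relevant slopes are nonzero, so the minimiser is
  unique.\<close>

lemma lagrangian_bound_strict:
  fixes f c :: "nat \<Rightarrow> real"
  assumes "0 \<le> c i" "0 < v" "0 \<le> f i" "i \<noteq> k"
    and "i < k \<Longrightarrow> v < f i" "k < i \<Longrightarrow> f i < v"
    and eq: "f i * (A - greedy_fill A m k i) - v * (c i - greedy_fill A m k i)
      = f i * max 0 (A - c i)"
  shows "c i = greedy_fill A m k i"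
proof (cases "i < k")
  case True
  then have e: "v * (A - c i) = f i * max 0 (A - c i)"
    using eq by (simp add: greedy_fill_def algebra_simps)
  have "A - c i = 0"
  proof (cases "A - c i \<ge> 0")
    case nonneg: True
    then have "(f i - v) * (A - c i) = 0"
      using e by (simp add: algebra_simps max_def)
    then show ?thesis
      using assms(5)[OF True] by simp
  next
    case False
    then have "v * (A - c i) = 0"
      using e by simp
    then show ?thesis
      using assms(2) by simp
  qed
  then show ?thesis
    using True by (simp add: greedy_fill_def)
next
  case False
  then have "k < i" using assms(4) by simp
  have "f i * (A - c i) \<le> f i * max 0 (A - c i)"
    using assms by (intro mult_left_mono) auto
  then have "(v - f i) * c i \<le> 0"
    using eq \<open>k < i\<close> by (simp add: greedy_fill_def algebra_simps)
  then have "c i = 0"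
    using assms(1) assms(6)[OF \<open>k < i\<close>] by (simp add: mult_le_0_iff)
  then show ?thesis
    using \<open>k < i\<close> by (simp add: greedy_fill_def)
qed

lemma greedy_fill_optimal:
  fixes f c :: "nat \<Rightarrow> real"
  assumes c: "\<And>i. i \<in> {1..F} \<Longrightarrow> 0 \<le> c i" "(\<Sum>i=1..F. c i) \<le> m"
    and f: "\<And>i. i \<in> {1..F} \<Longrightarrow> 0 \<le> f i"
      "\<And>i j. 1 \<le> i \<Longrightarrow> i \<le> j \<Longrightarrow> j \<le> F \<Longrightarrow> f j \<le> f i"
    and k: "1 \<le> k"
  shows "(\<Sum>i=1..F. f i * (A - greedy_fill A m k i)) \<le> (\<Sum>i=1..F. f i * max 0 (A - c i))"
proof -
  \<comment> \<open>For \<open>k > F\<close> the greedy sum need not equal \<open>m\<close>, so the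
    multiplier of the capacity constraint is taken to be 0.\<close>
  define v where "v = (if k \<le> F then f k else 0)"
  let ?g = "greedy_fill A m k"
  have "v * (\<Sum>i=1..F. c i - ?g i) \<le> 0"
  proof (cases "k \<le> F")
    case True
    then show ?thesis
      using c f(1)[of k] k sum_greedy_fill[of k F A m]
      by (simp add: v_def sum_subtractf mult_nonneg_nonpos)
  qed (simp add: v_def)
  moreover have "(\<Sum>i=1..F. f i * (A - ?g i) - v * (c i - ?g i))
    \<le> (\<Sum>i=1..F. f i * max 0 (A - c i))"
    using c f k by (intro sum_mono lagrangian_bound) (auto simp: v_def)
  ultimately show ?thesis
    by (simp add: sum_subtractf flip: sum_distrib_left)
qed

lemma greedy_fill_unique:
  fixes f c :: "nat \<Rightarrow> real"
  assumes c: "\<And>i. i \<in> {1..F} \<Longrightarrow> 0 \<le> c i" "(\<Sum>i=1..F. c i) \<le> m"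
    and f: "\<And>i. i \<in> {1..F} \<Longrightarrow> 0 < f i"
      "\<And>i j. 1 \<le> i \<Longrightarrow> i < j \<Longrightarrow> j \<le> F \<Longrightarrow> f j < f i"
    and k: "1 \<le> k" "k \<le> F"
    and le: "(\<Sum>i=1..F. f i * max 0 (A - c i)) \<le> (\<Sum>i=1..F. f i * (A - greedy_fill A m k i))"
    and i: "i \<in> {1..F}"
  shows "c i = greedy_fill A m k i"
proof -
  let ?g = "greedy_fill A m k"
  let ?l = "\<lambda>i. f i * (A - ?g i) - f k * (c i - ?g i)"
  let ?r = "\<lambda>i. f i * max 0 (A - c i)"
  have fk: "0 < f k" using f k by simp
  have bound: "?l j \<le> ?r j" if "j \<in> {1..F}" for j
    using c f k that by (intro lagrangian_bound) (auto intro: less_imp_le)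
  have suml: "(\<Sum>i=1..F. ?l i)
      = (\<Sum>i=1..F. f i * (A - ?g i)) - f k * ((\<Sum>i=1..F. c i) - m)"
    using sum_greedy_fill[OF k, of A m]
    by (simp add: sum_subtractf flip: sum_distrib_left)
  \<comment> \<open>With \<open>le\<close> this closes a cycle of inequalities, so all are
    equalities: the capacity is used up and each summand attains its bound.\<close>
  have "(\<Sum>i=1..F. ?l i) \<le> (\<Sum>i=1..F. ?r i)"
    by (intro sum_mono bound)
  moreover have "f k * ((\<Sum>i=1..F. c i) - m) \<le> 0"
    using c fk by (simp add: mult_nonneg_nonpos)
  ultimately have sum_eq: "(\<Sum>i=1..F. ?l i) = (\<Sum>i=1..F. ?r i)"
    and "f k * ((\<Sum>i=1..F. c i) - m) = 0"
    using suml le by linarith+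
  then have sum_c: "(\<Sum>i=1..F. c i) = m"
    using fk by simp
  have "(\<Sum>i=1..F. ?r i - ?l i) = 0"
    using sum_eq by (simp only: sum_subtractf)
  then have eq: "?l j = ?r j" if "j \<in> {1..F}" for j
    using that bound by (subst (asm) sum_nonneg_eq_0_iff) auto
  have off: "c j = ?g j" if "j \<in> {1..F}" "j \<noteq> k" for j
    using c f k that eq[OF that(1)] fk
    by (intro lagrangian_bound_strict[where v = "f k" and f = f]) (auto intro: less_imp_le)
  \<comment> \<open>The bound at \<open>k\<close> is flat on \<open>[0, A]\<close> and does not
    determine \<open>c k\<close>; the equal totals do.\<close>
  have "(\<Sum>i=1..F. c i) = (\<Sum>i=1..F. ?g i)"
    using sum_c sum_greedy_fill[OF k, of A m] by simp
  moreover have "(\<Sum>i\<in>{1..F} - {k}. c i) = (\<Sum>i\<in>{1..F} - {k}. ?g i)"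
    using off by (intro sum.cong) auto
  ultimately have "c k = ?g k"
    using k by (simp add: sum.remove[of _ k])
  with off i show ?thesis by blast
qed

section \<open>Solution of the caching problem\<close>

lemma feasible_cache_no_capacity:
  fixes c :: "nat \<Rightarrow> real"
  assumes "feasible_cache F L 0 c" "i \<in> {1..F}"
  shows "c i = 0"
proof -
  have "(\<Sum>i=1..F. c i) = 0"
    using assms(1) by (auto simp: feasible_cache_def intro!: antisym sum_nonneg)
  then show ?thesis
    using assms by (subst (asm) sum_nonneg_eq_0_iff) (auto simp: feasible_cache_def)
qed

lemma bs_load_nonneg: "0 \<le> bs_load F L \<gamma> z c"
  unfolding bs_load_def
  by (intro sum_nonneg mult_nonneg_nonneg) (use zipf_pos in \<open>auto intro: less_imp_le\<close>)

text \<open>A single \<zeta> presupposes that all contents have the same delivery. Uniqueness is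
  claimed on \<open>{1..F}\<close>, outside which neither load nor constraints look. For
  \<open>\<gamma> = 0\<close> equal weights allow exchanges between contents; for
  \<open>M > F * (L - \<zeta>)\<close> spare capacity may be spent without changing a zero
  load.\<close>

theorem theorem2:
  fixes F L M :: nat
    and \<gamma> b \<eta> lam \<mu> R \<alpha> Pt \<sigma> \<tau> \<zeta> :: real
    and q :: "nat \<Rightarrow> nat pmf"
  defines "z \<equiv> (\<lambda>i. d2d_delivery F L M b \<eta> lam \<mu> R \<alpha> Pt \<sigma> \<tau> (q i) i)"
  assumes "F \<ge> 1" and "L \<ge> 1"
    and "\<gamma> \<ge> 0"
    and "b > 1"
    and "0 \<le> \<eta>" and "\<eta> \<le> 1" and "lam > 0" and "\<mu> > 0"
    and "R > 0" and "\<alpha> > 0" and "Pt > 0" and "\<sigma> > 0" and "\<tau> > 0"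
    and "\<And>i. i \<in> {1..F} \<Longrightarrow> set_pmf (q i) \<subseteq> feasible_counts F L M i"
    and "\<And>i. i \<in> {1..F} \<Longrightarrow> \<zeta> = z i"
  shows "is_arg_min (bs_load F L \<gamma> z) (feasible_cache F L M) (c_NOM L M \<zeta>) \<and>
    (\<gamma> > 0 \<and> real M \<le> real F * (real L - \<zeta>) \<longrightarrow>
      (\<forall>c. is_arg_min (bs_load F L \<gamma> z) (feasible_cache F L M) c \<longrightarrow>
        (\<forall>i\<in>{1..F}. c i = c_NOM L M \<zeta> i)))"
proof -
  define A where "A = real L - \<zeta>"
  define k where "k = nat \<lceil>real M / A\<rceil>"
  let ?g = "greedy_fill A (real M) k"
  \<comment> \<open>Content 1 exists since \<open>F \<ge> 1\<close>. The sign yields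
    \<open>A \<le> L\<close>, which the constraint \<open>c i \<le> L\<close> demands of the greedy
    point.\<close>
  have \<zeta>0: "0 \<le> \<zeta>"
    using d2d_delivery_nonneg[of 1 F b \<eta> lam \<mu> R Pt \<tau> L M \<alpha> \<sigma> "q 1"] assms(16)[of 1] assms(2-14)
    by (simp add: z_def)
  have load: "bs_load F L \<gamma> z c = (\<Sum>i=1..F. zipf F \<gamma> i * max 0 (A - c i))" for c
    unfolding bs_load_def
  proof (intro sum.cong refl)
    fix i assume "i \<in> {1..F}"
    then have "z i = \<zeta>" using assms by metis
    then show "zipf F \<gamma> i * max 0 (real L - c i - z i) = zipf F \<gamma> i * max 0 (A - c i)"
      by (simp add: A_def algebra_simps)
  qed
  have zero_case: "feasible_cache F L M (c_NOM L M \<zeta>)"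
    if "\<And>i. i \<in> {1..F} \<Longrightarrow> c_NOM L M \<zeta> i = 0"
    using that by (auto simp: feasible_cache_def)
  consider (nonpos) "A \<le> 0" | (empty) "A > 0" "M = 0" | (pos) "A > 0" "M > 0"
    by linarith
  then show ?thesis
  proof cases
    case nonpos
    \<comment> \<open>This includes \<open>A = 0\<close>, where the quotient is 0 by convention;
      every content then lies beyond the ceiling.\<close>
    then have "real M / A \<le> 0"
      by (simp add: divide_nonneg_nonpos)
    then have ceil: "\<lceil>real M / A\<rceil> \<le> 0"
      by simp
    have cz: "c_NOM L M \<zeta> i = 0" if "i \<in> {1..F}" for i
    proof -
      have "\<lceil>real M / A\<rceil> < int i"
        by (rule le_less_trans[OF ceil]) (use that in simp)
      \<comment> \<open>These refute both conditions in \<open>c_NOM\<close>, leaving its last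
        branch.\<close>
      note this[THEN less_not_sym] this[THEN less_imp_neq, THEN not_sym]
      then show ?thesis
        by (simp only: c_NOM_def Let_def A_def[symmetric] if_False)
    qed
    have "bs_load F L \<gamma> z (c_NOM L M \<zeta>) = 0"
      unfolding load using nonpos cz by (intro sum.neutral) auto
    then have opt: "is_arg_min (bs_load F L \<gamma> z) (feasible_cache F L M) (c_NOM L M \<zeta>)"
      using zero_case[OF cz] bs_load_nonneg by (simp add: is_arg_min_linorder)
    \<comment> \<open>Here the capacity condition of the uniqueness claim leaves only
      \<open>M = 0\<close>, hence only the empty cache.\<close>
    have "M = 0" if "real M \<le> real F * A"
      using that nonpos mult_nonneg_nonpos[of "real F" A] by auto
    moreover have "c i = c_NOM L M \<zeta> i"
      if "M = 0" "is_arg_min (bs_load F L \<gamma> z) (feasible_cache F L M) c" "i \<in> {1..F}" for c i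
      using that cz feasible_cache_no_capacity[of F L c i] by (simp add: is_arg_min_def)
    ultimately show ?thesis
      unfolding A_def[symmetric] using opt by blast
  next
    case empty
    have cz: "c_NOM L M \<zeta> i = 0" if "i \<in> {1..F}" for i
      using that empty unfolding c_NOM_def A_def[symmetric] by auto
    have "bs_load F L \<gamma> z (c_NOM L M \<zeta>) \<le> bs_load F L \<gamma> z c" if "feasible_cache F L M c" for c
      unfolding load using that empty cz feasible_cache_no_capacity[of F L c]
      by (intro eq_refl sum.cong) auto
    then have "is_arg_min (bs_load F L \<gamma> z) (feasible_cache F L M) (c_NOM L M \<zeta>)"
      using zero_case[OF cz] unfolding is_arg_min_linorder by blast
    moreover have "c i = c_NOM L M \<zeta> i"
      if "is_arg_min (bs_load F L \<gamma> z) (feasible_cache F L M) c" "i \<in> {1..F}" for c i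
      using that empty cz feasible_cache_no_capacity[of F L c i] by (simp add: is_arg_min_def)
    ultimately show ?thesis
      by blast
  next
    case pos
    have cg: "c_NOM L M \<zeta> = ?g"
      using c_NOM_eq_greedy_fill[where \<zeta> = \<zeta> and L = L and M = M] pos(1) unfolding A_def k_def by blast
    have "0 < real M / A" using pos by simp
    then have "1 \<le> \<lceil>real M / A\<rceil>"
      by simp
    then have k_int: "\<lceil>real M / A\<rceil> = int k" and kc: "1 \<le> k"
      unfolding k_def by linarith+
    have "real k - 1 < real M / A" "real M / A \<le> real k"
      using ceiling_correct[of "real M / A"] unfolding k_int by simp_all
    with pos have kM: "(real k - 1) * A < real M" "real M \<le> real k * A"
      by (simp_all add: field_simps)
    have gb: "0 \<le> ?g i \<and> ?g i \<le> A" for i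
      using pos kM by (intro greedy_fill_bounds) auto
    have "(\<Sum>i=1..F. ?g i) \<le> real M"
    proof (cases "k \<le> F")
      case True
      show ?thesis
        by (rule eq_refl[OF sum_greedy_fill[OF kc True]])
    next
      case False
      have "(\<Sum>i=1..F. ?g i) \<le> (\<Sum>i=1..F. A)"
        using gb by (intro sum_mono) auto
      also have "\<dots> \<le> (real k - 1) * A"
        using False pos by (auto intro!: mult_right_mono)
      finally show ?thesis
        using kM by simp
    qed
    moreover have "?g i \<le> real L" for i
      using gb[of i] \<zeta>0 by (simp add: A_def)
    ultimately have feas: "feasible_cache F L M ?g"
      using gb by (simp add: feasible_cache_def)
    have load_g: "bs_load F L \<gamma> z ?g = (\<Sum>i=1..F. zipf F \<gamma> i * (A - ?g i))"
      unfolding load using gb by (simp add: max_def)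
    have opt: "is_arg_min (bs_load F L \<gamma> z) (feasible_cache F L M) ?g"
      unfolding is_arg_min_linorder
    proof (intro conjI feas allI impI)
      fix c :: "nat \<Rightarrow> real"
      assume "feasible_cache F L M c"
      then show "bs_load F L \<gamma> z ?g \<le> bs_load F L \<gamma> z c"
        unfolding load_g unfolding load
        using kc assms(4) zipf_pos zipf_antimono
        by (intro greedy_fill_optimal) (auto simp: feasible_cache_def intro: less_imp_le)
    qed
    have "c i = ?g i"
      if "\<gamma> > 0" "real M \<le> real F * A"
        "is_arg_min (bs_load F L \<gamma> z) (feasible_cache F L M) c" "i \<in> {1..F}" for c i
    proof -
      have "(real k - 1) * A < real F * A"
        using kM that by linarith
      then have "k \<le> F"
        using pos by (simp add: mult_less_cancel_right)
      have "bs_load F L \<gamma> z c \<le> bs_load F L \<gamma> z ?g"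
        using that(3) feas by (simp add: is_arg_min_linorder)
      then have "(\<Sum>i=1..F. zipf F \<gamma> i * max 0 (A - c i))
        \<le> (\<Sum>i=1..F. zipf F \<gamma> i * (A - ?g i))"
        unfolding load_g unfolding load .
      then show ?thesis
        using that kc \<open>k \<le> F\<close> zipf_pos zipf_strict_antimono
        by (intro greedy_fill_unique[of F c "real M" "zipf F \<gamma>"])
          (auto simp: feasible_cache_def is_arg_min_def)
    qed
    with opt show ?thesis
      unfolding cg A_def[symmetric] by blast
  qed
qed

end
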